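(* Every 3-connected 4-regular simple graph $G$ with an even number of vertices, at most 18, is 3PM-admissible.
   Context: A 3-connected 4-regular graph with an even number of vertices is matching covered (connected, every edge in some perfect matching). A matching covered graph $G$ is 3PM-admissible if there exist three perfect matchings $M_1,M_2,M_3$ of $G$ with $M_1\cap M_2\cap M_3=\emptyset$. *)

theory Defs
  imports Main
begin

text \<open>
  A finite simple graph is given by a vertex set \<open>V\<close> and a set \<open>E\<close> of two-element subsets of \<open>V\<close>.
\<close>

definition simple_graph :: "'a set \<Rightarrow> 'a set set \<Rightarrow> bool" where
  "simple_graph V E \<longleftrightarrow> finite V \<and> (\<forall>e\<in>E. e \<subseteq> V \<and> card e = 2)"

definition graph_degree :: "'a set set \<Rightarrow> 'a \<Rightarrow> nat" where
  "graph_degree E v = card {e \<in> E. v \<in> e}"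

definition graph_regular :: "nat \<Rightarrow> 'a set \<Rightarrow> 'a set set \<Rightarrow> bool" where
  "graph_regular d V E \<longleftrightarrow> (\<forall>v\<in>V. graph_degree E v = d)"

definition graph_connected :: "'a set \<Rightarrow> 'a set set \<Rightarrow> bool" where
  "graph_connected V E \<longleftrightarrow>
     V \<noteq> {} \<and> (\<forall>u\<in>V. \<forall>v\<in>V. (u, v) \<in> {(x, y). x \<in> V \<and> y \<in> V \<and> {x, y} \<in> E}\<^sup>*)"

text \<open>
  A graph is \<open>k\<close>-connected if it has more than \<open>k\<close> vertices and deleting fewer than \<open>k\<close> vertices
  (with their incident edges) never disconnects it.
\<close>

definition vertex_connected :: "nat \<Rightarrow> 'a set \<Rightarrow> 'a set set \<Rightarrow> bool" where
  "vertex_connected k V E \<longleftrightarrow>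
     card V > k \<and>
     (\<forall>S. S \<subseteq> V \<and> card S < k \<longrightarrow> graph_connected (V - S) {e \<in> E. e \<inter> S = {}})"

definition perfect_matching :: "'a set \<Rightarrow> 'a set set \<Rightarrow> 'a set set \<Rightarrow> bool" where
  "perfect_matching V E M \<longleftrightarrow> M \<subseteq> E \<and> (\<forall>v\<in>V. \<exists>!e. e \<in> M \<and> v \<in> e)"

definition matching_covered :: "'a set \<Rightarrow> 'a set set \<Rightarrow> bool" where
  "matching_covered V E \<longleftrightarrow>
     graph_connected V E \<and> (\<forall>e\<in>E. \<exists>M. perfect_matching V E M \<and> e \<in> M)"

text \<open>
  Admissibility is a property of matching covered graphs, so being matching covered is part of
  the predicate.  The three perfect matchings need not be distinct.
\<close>

definition three_PM_admissible :: "'a set \<Rightarrow> 'a set set \<Rightarrow> bool" where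
  "three_PM_admissible V E \<longleftrightarrow>
     matching_covered V E \<and>
     (\<exists>M1 M2 M3. perfect_matching V E M1 \<and> perfect_matching V E M2 \<and> perfect_matching V E M3 \<and>
        M1 \<inter> M2 \<inter> M3 = {})"

end

theory Submission imports Defs begin

text \<open>
  In a 3-connected 4-regular graph every edge cut is even, hence has at least four edges, and
  Tutte's theorem gives a perfect matching through any prescribed edge.  Fix a perfect matching
  \<open>M\<close>.  If the cubic graph \<open>H = E - M\<close> has a perfect matching, we are done.  Otherwise a Tutte
  obstruction contains three odd sets cut off by bridges of \<open>H\<close>, and as there are at most 18
  vertices these three sets are determined by \<open>H\<close>.  Some edge \<open>f\<close> of \<open>M\<close> joins two of them, so
  adding \<open>f\<close> to \<open>H\<close> destroys every obstruction and yields a perfect matching that meets \<open>M\<close> in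
  at most \<open>f\<close>.  A third perfect matching through another edge at an end of \<open>f\<close> avoids \<open>f\<close>.
\<close>

subsection \<open>Hall's and Tutte's theorems\<close>

text \<open>The Halmos-Vaughan induction. If some proper nonempty \<open>J\<close> is tight,
  \<open>J\<close> and \<open>I - J\<close> are matched separately, the latter outside the
  neighbours of \<open>J\<close>. Otherwise every proper nonempty subfamily has a spare neighbour,
  so one index may take any of its neighbours at once.\<close>

lemma hall:
  fixes N :: "'i \<Rightarrow> 'b set"
  assumes "finite I" "\<And>i. i \<in> I \<Longrightarrow> finite (N i)"
    and "\<And>J. J \<subseteq> I \<Longrightarrow> card J \<le> card (\<Union>(N ` J))"
  shows "\<exists>f. inj_on f I \<and> (\<forall>i\<in>I. f i \<in> N i)"
  using assms
proof (induction "card I" arbitrary: I N rule: less_induct)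
  case less
  note fin = less.prems(1) and finN = less.prems(2) and hall = less.prems(3)
  have finU: "finite (\<Union>(N ` J))" if "J \<subseteq> I" for J
    using that fin finN by (auto intro: finite_subset)
  show ?case
  proof (cases "\<exists>J. J \<subset> I \<and> J \<noteq> {} \<and> card (\<Union>(N ` J)) \<le> card J")
    case True
    then obtain J where J: "J \<subset> I" "J \<noteq> {}" "card (\<Union>(N ` J)) \<le> card J" by blast
    have finJ: "finite J" using J fin by (auto intro: finite_subset)
    have eq: "card (\<Union>(N ` J)) = card J" using J hall[of J] by auto
    have lessJ: "card J < card I" using J fin by (simp add: psubset_card_mono)
    have "\<exists>f. inj_on f J \<and> (\<forall>i\<in>J. f i \<in> N i)"
      by (rule less.hyps[OF lessJ]) (use J finJ finN hall in auto)
    then obtain f where f: "inj_on f J" "\<And>i. i \<in> J \<Longrightarrow> f i \<in> N i" by blast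
    define N' where "N' i = N i - \<Union>(N ` J)" for i
    have "\<exists>g. inj_on g (I - J) \<and> (\<forall>i\<in>I - J. g i \<in> N' i)"
    proof (rule less.hyps)
      show "card (I - J) < card I"
        using J fin by (intro psubset_card_mono) auto
      \<comment> \<open>Hall's condition for \<open>J \<union> K\<close>, minus the tight count for
        \<open>J\<close>, is Hall's condition for \<open>K\<close> under \<open>N'\<close>.\<close>
      show "card K \<le> card (\<Union>(N' ` K))" if "K \<subseteq> I - J" for K
      proof -
        have finK: "finite K" using that fin by (auto intro: finite_subset)
        have "card (J \<union> K) = card J + card K"
          using that finJ finK by (intro card_Un_disjoint) auto
        moreover have "card (J \<union> K) \<le> card (\<Union>(N ` (J \<union> K)))"
          using that J by (intro hall) auto
        moreover have "\<Union>(N' ` K) = \<Union>(N ` (J \<union> K)) - \<Union>(N ` J)"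
          by (auto simp: N'_def)
        moreover have "card (\<Union>(N ` (J \<union> K)) - \<Union>(N ` J)) = card (\<Union>(N ` (J \<union> K))) - card (\<Union>(N ` J))"
          using finU[of J] J by (intro card_Diff_subset) auto
        ultimately show ?thesis using eq by simp
      qed
    qed (use fin finN N'_def in auto)
    then obtain g where g: "inj_on g (I - J)" "\<And>i. i \<in> I - J \<Longrightarrow> g i \<in> N' i" by blast
    define h where "h i = (if i \<in> J then f i else g i)" for i
    have "h i \<in> N i" if "i \<in> I" for i
      using that f(2)[of i] g(2)[of i] by (auto simp: h_def N'_def)
    moreover have "inj_on h I"
    proof (rule inj_onI)
      fix i j assume ij: "i \<in> I" "j \<in> I" "h i = h j"
      have fg: "f k \<noteq> g l" if "k \<in> J" "l \<in> I" "l \<notin> J" for k l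
        using that f(2)[of k] g(2)[of l] by (auto simp: N'_def)
      show "i = j"
      proof (cases "i \<in> J"; cases "j \<in> J")
        assume "i \<in> J" "j \<in> J"
        then show ?thesis using ij(3) inj_onD[OF f(1)] by (simp add: h_def)
      next
        assume "i \<notin> J" "j \<notin> J"
        then show ?thesis using ij inj_onD[OF g(1), of i j] by (simp add: h_def)
      next
        assume "i \<in> J" "j \<notin> J"
        then show ?thesis using ij fg[of i j] by (simp add: h_def)
      next
        assume "i \<notin> J" "j \<in> J"
        then show ?thesis using ij fg[of j i] by (simp add: h_def)
      qed
    qed
    ultimately show ?thesis by blast
  next
    case False
    have strict: "card J < card (\<Union>(N ` J))" if "J \<subset> I" "J \<noteq> {}" for J
      using False that by (metis not_le)
    show ?thesis
    proof (cases "I = {}")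
      case False
      then obtain i where i: "i \<in> I" by blast
      have "card {i} \<le> card (N i)" using hall[of "{i}"] i by auto
      then obtain x where x: "x \<in> N i" by fastforce
      have "\<exists>g. inj_on g (I - {i}) \<and> (\<forall>j\<in>I - {i}. g j \<in> N j - {x})"
      proof (rule less.hyps)
        show "card (I - {i}) < card I" using i fin by (intro card_Diff1_less)
        show "card K \<le> card (\<Union>j\<in>K. N j - {x})" if "K \<subseteq> I - {i}" for K
        proof (cases "K = {}")
          case False
          have "K \<subset> I" using that i by auto
          then have "card K < card (\<Union>(N ` K))"
            using False by (intro strict)
          moreover have "(\<Union>j\<in>K. N j - {x}) = \<Union>(N ` K) - {x}" by auto
          moreover have "card (\<Union>(N ` K)) - 1 \<le> card (\<Union>(N ` K) - {x})"
            by (simp add: card_Diff_singleton_if)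
          ultimately show ?thesis by simp
        qed auto
      qed (use fin finN in auto)
      then obtain g where g: "inj_on g (I - {i})" "\<And>j. j \<in> I - {i} \<Longrightarrow> g j \<in> N j - {x}" by blast
      have "inj_on (g(i := x)) (insert i (I - {i}))"
        using g by (auto simp: inj_on_def)
      then have "inj_on (g(i := x)) I" using i by (simp add: insert_absorb)
      moreover have "\<forall>j\<in>I. (g(i := x)) j \<in> N j" using g x by auto
      ultimately show ?thesis by blast
    qed auto
  qed
qed

text \<open>
  The members of \<open>C\<close> need not be connected nor cover \<open>V - T\<close>: unions of components of
  \<open>V - T\<close> serve as well as odd components in Tutte's condition.
\<close>

definition odd_family :: "'a set \<Rightarrow> 'a set set \<Rightarrow> 'a set \<Rightarrow> 'a set set \<Rightarrow> bool" where
  "odd_family V E T C \<longleftrightarrow> T \<subseteq> V \<and> pairwise disjnt C \<and>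
     (\<forall>X\<in>C. X \<subseteq> V - T \<and> odd (card X) \<and> (\<forall>e\<in>E. e \<inter> X \<noteq> {} \<longrightarrow> e \<subseteq> X \<union> T))"

lemma odd_familyD:
  assumes "odd_family V E T C"
  shows "T \<subseteq> V" and "pairwise disjnt C"
    and "X \<in> C \<Longrightarrow> X \<subseteq> V - T" and "X \<in> C \<Longrightarrow> odd (card X)" and "X \<in> C \<Longrightarrow> X \<noteq> {}"
    and "X \<in> C \<Longrightarrow> e \<in> E \<Longrightarrow> e \<inter> X \<noteq> {} \<Longrightarrow> e \<subseteq> X \<union> T"
proof -
  show "T \<subseteq> V" and "pairwise disjnt C"
    using assms unfolding odd_family_def by simp_all
  assume X: "X \<in> C"
  then show "X \<subseteq> V - T" and odd: "odd (card X)"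
    using assms unfolding odd_family_def by simp_all
  from odd show "X \<noteq> {}" by auto
  show "e \<subseteq> X \<union> T" if "e \<in> E" "e \<inter> X \<noteq> {}"
    using X that assms unfolding odd_family_def by simp
qed

lemma odd_family_finite:
  assumes "odd_family V E T C" "finite V"
  shows "finite T" "finite C" "X \<in> C \<Longrightarrow> finite X"
proof -
  show "finite T" using assms unfolding odd_family_def by (meson finite_subset)
  have "C \<subseteq> Pow V" using assms unfolding odd_family_def by auto
  then show "finite C" using assms(2) by (meson finite_Pow_iff finite_subset)
  show "finite X" if "X \<in> C" using \<open>C \<subseteq> Pow V\<close> that assms(2) by (meson PowD finite_subset subsetD)
qed

text \<open>An edge meeting a member leaves it only into \<open>T\<close>, so the vertices outside
  \<open>T\<close> and all members are closed off in the same way. If their number is odd, they can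
  join \<open>C\<close>.\<close>

lemma odd_family_rest_closed:
  assumes "odd_family V E T C" "\<forall>e\<in>E. e \<subseteq> V" "e \<in> E" "e \<inter> (V - T - \<Union>C) \<noteq> {}"
  shows "e \<subseteq> (V - T - \<Union>C) \<union> T"
proof
  fix x assume x: "x \<in> e"
  have "x \<notin> X" if X: "X \<in> C" for X
    using odd_familyD(6)[OF assms(1) X assms(3)] X x assms(4) by blast
  then show "x \<in> (V - T - \<Union>C) \<union> T" using x assms(2,3) by blast
qed

lemma odd_card_Union:
  assumes "finite C" "pairwise disjnt C" "\<And>X. X \<in> C \<Longrightarrow> odd (card X)"
  shows "even (card (\<Union>C)) \<longleftrightarrow> even (card C)"
proof -
  have "card (\<Union>C) = (\<Sum>X\<in>C. card X)"
    using assms by (intro card_Union_disjoint) (auto intro: card_ge_0_finite simp: odd_pos)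
  moreover have "even (\<Sum>X\<in>C. card X) \<longleftrightarrow> even (card C)"
    using assms(1,3) by (induction C rule: finite_induct) auto
  ultimately show ?thesis by simp
qed

text \<open>Used to bring two obstructions over a common vertex set before uniting them, and to pass
  to a subgraph.\<close>

lemma odd_family_shrink:
  assumes "odd_family V E T C" "C' \<subseteq> C" "T \<subseteq> S" "S \<subseteq> V" "S \<inter> \<Union>C' = {}" "F \<subseteq> E"
  shows "odd_family V F S C'"
  unfolding odd_family_def
proof (intro conjI ballI impI)
  show "pairwise disjnt C'" using odd_familyD(2)[OF assms(1)] assms(2) by (rule pairwise_subset)
  fix X assume X: "X \<in> C'"
  then have XC: "X \<in> C" using assms(2) by blast
  show "X \<subseteq> V - S" using odd_familyD(3)[OF assms(1) XC] X assms(5) by blast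
  show "odd (card X)" using odd_familyD(4)[OF assms(1) XC] .
  fix e assume "e \<in> F" "e \<inter> X \<noteq> {}"
  then show "e \<subseteq> X \<union> S"
    using odd_familyD(6)[OF assms(1) XC, of e] assms(3,6) by blast
qed (fact assms(4))

lemma odd_family_Un:
  assumes "odd_family V E T C" "odd_family V E T C'" "\<Union>C \<inter> \<Union>C' = {}"
  shows "odd_family V E T (C \<union> C')"
  unfolding odd_family_def
proof (intro conjI ballI impI)
  have "disjnt X Y" if "X \<in> C" "Y \<in> C'" for X Y
    using that assms(3) unfolding disjnt_def by blast
  then show "pairwise disjnt (C \<union> C')"
    using odd_familyD(2)[OF assms(1)] odd_familyD(2)[OF assms(2)]
    unfolding pairwise_def by (metis Un_iff disjnt_sym)
  fix X assume X: "X \<in> C \<union> C'"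
  show "X \<subseteq> V - T" "odd (card X)"
    using X odd_familyD(3,4)[OF assms(1)] odd_familyD(3,4)[OF assms(2)] by blast+
  show "e \<subseteq> X \<union> T" if "e \<in> E" "e \<inter> X \<noteq> {}" for e
    using X that odd_familyD(6)[OF assms(1)] odd_familyD(6)[OF assms(2)] by blast
qed (fact odd_familyD(1)[OF assms(1)])

lemma odd_family_insert:
  assumes "odd_family V E T C"
    and "Y \<subseteq> V - T" "Y \<inter> \<Union>C = {}" "odd (card Y)" "\<And>e. e \<in> E \<Longrightarrow> e \<inter> Y \<noteq> {} \<Longrightarrow> e \<subseteq> Y \<union> T"
  shows "odd_family V E T (insert Y C)"
proof -
  have "odd_family V E T {Y}"
    using assms odd_familyD(1)[OF assms(1)] by (simp add: odd_family_def)
  then show ?thesis using odd_family_Un[of V E T "{Y}" C] assms(1,3) by simp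
qed

lemma card_insert_disjoint_odd:
  assumes "finite C" "Y \<inter> \<Union>C = {}" "odd (card Y)"
  shows "card (insert Y C) = Suc (card C)"
proof -
  have "Y \<notin> C"
  proof
    assume "Y \<in> C"
    then have "Y = {}" using assms(2) by blast
    then show False using assms(3) by simp
  qed
  then show ?thesis using assms(1) by simp
qed

text \<open>Parity: \<open>card T + card C\<close> plus the number of left-over vertices has the
  parity of \<open>card V\<close>. An odd left-over set becomes a further member; otherwise the
  surplus of \<open>C\<close> over \<open>T\<close> is already even.\<close>

lemma odd_family_exceeds_by_two:
  assumes "odd_family V E T C" "simple_graph V E" "even (card V)" "card T < card C"
  shows "\<exists>C'. odd_family V E T C' \<and> card T + 2 \<le> card C'"
proof -
  have fV: "finite V" and EV: "\<forall>e\<in>E. e \<subseteq> V" using assms(2) by (auto simp: simple_graph_def)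
  note fin = odd_family_finite[OF assms(1) fV]
  note od = odd_familyD[OF assms(1)]
  let ?R = "V - T - \<Union>C"
  have parU: "even (card (\<Union>C)) \<longleftrightarrow> even (card C)"
    by (rule odd_card_Union) (use fin od in auto)
  have "card V = card (T \<union> \<Union>C) + card ?R"
  proof -
    have "V = (T \<union> \<Union>C) \<union> ?R" using od by blast
    moreover have "card ((T \<union> \<Union>C) \<union> ?R) = card (T \<union> \<Union>C) + card ?R"
      using fin fV by (intro card_Un_disjoint) auto
    ultimately show ?thesis by simp
  qed
  moreover have "card (T \<union> \<Union>C) = card T + card (\<Union>C)"
    using fin od by (intro card_Un_disjoint) auto
  ultimately have par: "even (card T + card C + card ?R)" using assms(3) parU by simp
  show ?thesis
  proof (cases "even (card ?R)")
    case True
    then have "even (card T + card C)" using par by simp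
    then have "card T + 2 \<le> card C" using assms(4) by (cases "card C = card T + 1") auto
    then show ?thesis using assms(1) by blast
  next
    case False
    have "odd_family V E T (insert ?R C)"
      by (rule odd_family_insert[OF assms(1)]) (use False odd_family_rest_closed[OF assms(1) EV] in auto)
    moreover have "card (insert ?R C) = Suc (card C)"
      by (rule card_insert_disjoint_odd) (use fin False in auto)
    ultimately show ?thesis using assms(4) by (intro exI[of _ "insert ?R C"]) simp
  qed
qed

section \<open>Gluing perfect matchings and lifting obstructions\<close>

lemma perfect_matching_insert:
  assumes "perfect_matching X E M" "\<forall>e\<in>E. e \<subseteq> X" "u \<notin> X" "v \<notin> X"
  shows "perfect_matching (insert u (insert v X)) (insert {u, v} E) (insert {u, v} M)"
  unfolding perfect_matching_def
proof (intro conjI ballI)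
  show "insert {u, v} M \<subseteq> insert {u, v} E"
    using assms(1) unfolding perfect_matching_def by blast
  have MX: "e \<subseteq> X" if "e \<in> M" for e
    using that assms(1,2) unfolding perfect_matching_def by blast
  fix w assume w: "w \<in> insert u (insert v X)"
  show "\<exists>!e. e \<in> insert {u, v} M \<and> w \<in> e"
  proof (cases "w \<in> X")
    case True
    then have "\<exists>!e. e \<in> M \<and> w \<in> e" "w \<notin> {u, v}"
      using assms(1,3,4) unfolding perfect_matching_def by blast+
    then show ?thesis by (metis insert_iff)
  next
    case False
    then have "w \<in> {u, v}" "\<And>e. e \<in> M \<Longrightarrow> w \<notin> e" using w MX by blast+
    then show ?thesis by (metis insert_iff)
  qed
qed

text \<open>Edges of one part stay inside it and the parts are disjoint, so an edge of the union at
  a vertex comes from the part of that vertex.\<close>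

lemma perfect_matching_Union:
  assumes "\<And>i. i \<in> I \<Longrightarrow> perfect_matching (A i) (E i) (M i)"
    and "\<And>i e. i \<in> I \<Longrightarrow> e \<in> E i \<Longrightarrow> e \<subseteq> A i"
    and "\<And>i j. i \<in> I \<Longrightarrow> j \<in> I \<Longrightarrow> i \<noteq> j \<Longrightarrow> A i \<inter> A j = {}"
  shows "perfect_matching (\<Union>(A ` I)) (\<Union>(E ` I)) (\<Union>(M ` I))"
  unfolding perfect_matching_def
proof (intro conjI ballI)
  show "\<Union>(M ` I) \<subseteq> \<Union>(E ` I)"
    using assms(1) unfolding perfect_matching_def by blast
  fix v assume "v \<in> \<Union>(A ` I)"
  then obtain i where i: "i \<in> I" "v \<in> A i" by blast
  obtain e where e: "e \<in> M i" "v \<in> e" and uniq: "\<And>e'. e' \<in> M i \<Longrightarrow> v \<in> e' \<Longrightarrow> e' = e"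
    using assms(1)[OF i(1)] i(2) unfolding perfect_matching_def by blast
  have "e' = e" if "e' \<in> M j" "j \<in> I" "v \<in> e'" for e' j
  proof -
    have "e' \<subseteq> A j" using that assms(1)[OF that(2)] assms(2)[OF that(2)] unfolding perfect_matching_def by blast
    then have "j = i" using assms(3)[OF i(1) that(2)] i(2) that(3) by blast
    then show ?thesis using that uniq by blast
  qed
  then have "e' = e" if "e' \<in> \<Union>(M ` I) \<and> v \<in> e'" for e' using that by blast
  moreover have "e \<in> \<Union>(M ` I) \<and> v \<in> e" using e i(1) by blast
  ultimately show "\<exists>!e. e \<in> \<Union>(M ` I) \<and> v \<in> e" by (rule ex1I[rotated])
qed

lemma perfect_matching_mono:
  assumes "perfect_matching V E M" "E \<subseteq> E'"
  shows "perfect_matching V E' M"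
  using assms subset_trans[of M E E'] by (simp add: perfect_matching_def)

lemma edge_eq:
  assumes "simple_graph V E" "e \<in> E" "a \<in> e"
  obtains b where "e = {a, b}" "a \<noteq> b" "a \<in> V" "b \<in> V"
proof -
  have "card e = 2" "e \<subseteq> V" using assms by (auto simp: simple_graph_def)
  then show ?thesis using assms(3) that by (auto simp: card_2_iff)
qed

text \<open>The edges at \<open>W\<close> that the induced graph forgets all go to \<open>S\<close>,
  so adding \<open>S\<close> to \<open>T\<close> absorbs them.\<close>

lemma odd_family_lift:
  assumes "odd_family W {e \<in> E. e \<subseteq> W} T C" "simple_graph V E" "W \<subseteq> V" "S \<subseteq> V" "S \<inter> W = {}"
    and closed: "\<And>e. e \<in> E \<Longrightarrow> e \<inter> W \<noteq> {} \<Longrightarrow> e \<subseteq> W \<union> S"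
  shows "odd_family V E (T \<union> S) C"
  unfolding odd_family_def
proof (intro conjI ballI impI)
  note od = odd_familyD[OF assms(1)]
  show "T \<union> S \<subseteq> V" using od(1) assms(3,4) by blast
  show "pairwise disjnt C" by (fact od(2))
  fix X assume X: "X \<in> C"
  show "X \<subseteq> V - (T \<union> S)" using od(3)[OF X] assms(3,5) by blast
  show "odd (card X)" using od(4)[OF X] .
  fix e assume e: "e \<in> E" "e \<inter> X \<noteq> {}"
  then obtain a where a: "a \<in> e" "a \<in> X" by blast
  then obtain b where b: "e = {a, b}" using edge_eq[OF assms(2) e(1)] by blast
  have aW: "a \<in> W" using od(3)[OF X] a by blast
  then have "b \<in> W \<union> S" using closed[OF e(1)] a b by blast
  then show "e \<subseteq> X \<union> (T \<union> S)"
  proof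
    assume "b \<in> W"
    then have "e \<subseteq> X \<union> T" using od(6)[OF X _ e(2)] e(1) b aW by simp
    then show ?thesis by blast
  qed (use a b in blast)
qed

lemma simple_graph_induced:
  "simple_graph V E \<Longrightarrow> W \<subseteq> V \<Longrightarrow> simple_graph W {e \<in> E. e \<subseteq> W}"
  unfolding simple_graph_def by (auto intro: finite_subset)

text \<open>
  Anderson's proof: for a tight obstruction with \<open>T\<close> of maximal size, deleting any vertex from a
  member of \<open>C\<close> leaves a matchable set, and Hall's theorem matches \<open>C\<close> with \<open>T\<close>.
\<close>

lemma tutte:
  assumes "simple_graph V E" "\<And>T C. odd_family V E T C \<Longrightarrow> card C \<le> card T"
  shows "\<exists>M. perfect_matching V E M"
  using assms
proof (induction "card V" arbitrary: V E rule: less_induct)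
  case (less V E)
  note simple = less.prems(1) and cond = less.prems(2)
  have fV: "finite V" and EV: "\<forall>e\<in>E. e \<subseteq> V" using simple by (auto simp: simple_graph_def)
  \<comment> \<open>Tight pairs: the empty one qualifies and \<open>card V\<close> bounds
    \<open>card T\<close>, so a pair with \<open>card T\<close> maximal exists.\<close>
  define P where "P p \<longleftrightarrow> odd_family V E (fst p) (snd p) \<and> card (snd p) = card (fst p)" for p
  have "P ({}, {})" by (simp add: P_def odd_family_def)
  moreover have "\<forall>p. P p \<longrightarrow> card (fst p) < Suc (card V)"
    using fV odd_familyD(1) by (metis P_def card_mono le_imp_less_Suc)
  ultimately obtain p where p: "P p" "\<And>q. P q \<Longrightarrow> card (fst q) \<le> card (fst p)"
    using ex_has_greatest_nat[of P _ "\<lambda>p. card (fst p)"] by blast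
  obtain T C where TC: "p = (T, C)" by fastforce
  have of: "odd_family V E T C" and cTC: "card C = card T" using p(1) TC by (auto simp: P_def)
  \<comment> \<open>\<open>cond\<close> gives the reverse inequality, so any such pair is tight and
    competes with the maximum.\<close>
  have max: "card S \<le> card T" if "odd_family V E S D" "card S \<le> card D" for S D
    using p(2)[of "(S, D)"] that cond[OF that(1)] TC by (simp add: P_def)
  note od = odd_familyD[OF of] and fin = odd_family_finite[OF of fV]
  \<comment> \<open>An odd rest would be a further member, against \<open>cond\<close>. From a
    nonempty even rest, moving one vertex to \<open>T\<close> and taking the others as a new member
    would give a tight pair with larger \<open>T\<close>.\<close>
  have cover: "V - T - \<Union>C = {}"
  proof (rule ccontr)
    let ?R = "V - T - \<Union>C"
    assume "?R \<noteq> {}"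
    then obtain v where v: "v \<in> ?R" by blast
    show False
    proof (cases "odd (card ?R)")
      case True
      have "odd_family V E T (insert ?R C)"
        by (rule odd_family_insert[OF of]) (use True odd_family_rest_closed[OF of EV] in auto)
      then have "card (insert ?R C) \<le> card T" by (rule cond)
      moreover have "card (insert ?R C) = Suc (card C)"
        by (rule card_insert_disjoint_odd) (use fin True in auto)
      ultimately show False using cTC by simp
    next
      case False
      have "card ?R = Suc (card (?R - {v}))" using v fV by (intro card.remove) auto
      then have odd: "odd (card (?R - {v}))" using False by simp
      have "odd_family V E (insert v T) C"
        by (rule odd_family_shrink[OF of]) (use v od in auto)
      then have "odd_family V E (insert v T) (insert (?R - {v}) C)"
      proof (rule odd_family_insert)
        show "e \<subseteq> ?R - {v} \<union> insert v T" if "e \<in> E" "e \<inter> (?R - {v}) \<noteq> {}" for e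
          using odd_family_rest_closed[OF of EV that(1)] that(2) by blast
      qed (use odd in auto)
      moreover have "card (insert (?R - {v}) C) = Suc (card C)"
        by (rule card_insert_disjoint_odd) (use fin odd in auto)
      ultimately have "card (insert v T) \<le> card T"
        using cTC fin v by (intro max) auto
      then show False using v fin by simp
    qed
  qed
  have near: "\<exists>M. perfect_matching (X - {v}) {e \<in> E. e \<subseteq> X - {v}} M" if X: "X \<in> C" and v: "v \<in> X" for X v
  proof (rule less.hyps)
    have XV: "X \<subseteq> V" and fX: "finite X" using od(3)[OF X] fV by (auto intro: finite_subset)
    show "card (X - {v}) < card V"
      using XV v fV by (intro psubset_card_mono) auto
    show simpleX: "simple_graph (X - {v}) {e \<in> E. e \<subseteq> X - {v}}"
      using XV by (intro simple_graph_induced[OF simple]) auto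
    fix S D assume ofS: "odd_family (X - {v}) {e \<in> E. e \<subseteq> X - {v}} S D"
    show "card D \<le> card S"
    proof (rule ccontr)
      assume "\<not> card D \<le> card S"
      moreover have "even (card (X - {v}))" using od(4)[OF X] v fX by simp
      ultimately obtain D' where D': "odd_family (X - {v}) {e \<in> E. e \<subseteq> X - {v}} S D'" "card S + 2 \<le> card D'"
        using odd_family_exceeds_by_two[OF ofS simpleX] by auto
      note odS = odd_familyD[OF D'(1)]
      have finS: "finite S" "finite D'" using odd_family_finite[OF D'(1)] fX by auto
      have DX: "\<Union>D' \<subseteq> X" using odS(3) by blast
      have CX: "\<Union>(C - {X}) \<inter> X = {}"
        using od(2) X by (auto simp: pairwise_def disjnt_def)
      \<comment> \<open>Replacing \<open>X\<close> by the members of \<open>D'\<close> and adding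
        \<open>v\<close> and \<open>S\<close> to \<open>T\<close> gains at least
        \<open>card S + 1\<close> members and exactly \<open>card S + 1\<close> vertices, so
        \<open>max\<close> applies to a set strictly larger than \<open>T\<close>.\<close>
      let ?S = "S \<union> insert v T"
      have of1: "odd_family V E ?S D'"
      proof (rule odd_family_lift[OF D'(1) simple])
        show "e \<subseteq> X - {v} \<union> insert v T" if "e \<in> E" "e \<inter> (X - {v}) \<noteq> {}" for e
          using od(6)[OF X that(1)] that(2) by blast
      qed (use XV od(1) od(3)[OF X] v in auto)
      have of2: "odd_family V E ?S (C - {X})"
      proof (rule odd_family_shrink[OF of])
        show "?S \<subseteq> V" using odS(1) XV od(1) v by blast
        have "T \<inter> \<Union>C = {}" using od(3) by blast
        then show "?S \<inter> \<Union>(C - {X}) = {}" using odS(1) CX v by blast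
      qed auto
      have "\<Union>D' \<inter> \<Union>(C - {X}) = {}" using DX CX by blast
      from odd_family_Un[OF of1 of2 this]
      have ofU: "odd_family V E ?S (D' \<union> (C - {X}))" .
      have "D' \<inter> (C - {X}) = {}" using DX CX odS(5) by blast
      then have "card (D' \<union> (C - {X})) = card D' + (card C - 1)"
        using finS fin X by (subst card_Un_disjoint) auto
      moreover have "0 < card C" using X fin by (auto simp: card_gt_0_iff)
      moreover have cS: "card ?S = card S + Suc (card T)"
        using finS fin v od(3)[OF X] odS(1) by (subst card_Un_disjoint) auto
      ultimately have "card ?S \<le> card (D' \<union> (C - {X}))" using D'(2) cTC by linarith
      then have "card ?S \<le> card T" by (rule max[OF ofU])
      then show False using cS by simp
    qed
  qed
  define N where "N X = {t \<in> T. \<exists>x\<in>X. {x, t} \<in> E}" for X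
  have "\<exists>f. inj_on f C \<and> (\<forall>X\<in>C. f X \<in> N X)"
  proof (rule hall)
    show "finite (N X)" for X using fin by (simp add: N_def)
    fix D assume D: "D \<subseteq> C"
    \<comment> \<open>The neighbours in \<open>T\<close> of the members of \<open>D\<close> already
      close these members off, so \<open>cond\<close> reads as Hall's condition.\<close>
    have "odd_family V E (\<Union>(N ` D)) D"
      unfolding odd_family_def
    proof (intro conjI ballI impI)
      show "\<Union>(N ` D) \<subseteq> V" using od(1) by (auto simp: N_def)
      show "pairwise disjnt D" using od(2) D by (rule pairwise_subset)
      fix X assume X: "X \<in> D"
      then have XC: "X \<in> C" using D by blast
      show "X \<subseteq> V - \<Union>(N ` D)" using od(3)[OF XC] by (auto simp: N_def)
      show "odd (card X)" using od(4)[OF XC] .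
      fix e assume e: "e \<in> E" "e \<inter> X \<noteq> {}"
      then obtain a where a: "a \<in> e" "a \<in> X" by blast
      then obtain b where b: "e = {a, b}" using edge_eq[OF simple e(1)] by blast
      have "b \<in> X \<union> T" using od(6)[OF XC e] b by blast
      then have "b \<in> X \<union> N X" using a b e(1) by (auto simp: N_def)
      then show "e \<subseteq> X \<union> \<Union>(N ` D)" using a b X by blast
    qed
    then show "card D \<le> card (\<Union>(N ` D))" by (rule cond)
  qed (use fin in auto)
  then obtain f where f: "inj_on f C" "\<And>X. X \<in> C \<Longrightarrow> f X \<in> N X" by blast
  \<comment> \<open>An injection between finite sets of equal size is onto, so the partners exhaust
    \<open>T\<close>.\<close>
  have fT: "f ` C = T"
  proof (rule card_subset_eq)
    show "f ` C \<subseteq> T" using f(2) by (auto simp: N_def)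
    show "card (f ` C) = card T" using f(1) cTC by (simp add: card_image)
  qed (use fin in auto)
  have "\<forall>X\<in>C. \<exists>x. x \<in> X \<and> {x, f X} \<in> E" using f(2) by (auto simp: N_def)
  then obtain x where x: "\<And>X. X \<in> C \<Longrightarrow> x X \<in> X" "\<And>X. X \<in> C \<Longrightarrow> {x X, f X} \<in> E" by metis
  \<comment> \<open>Each piece is a member of \<open>C\<close> with its partner in \<open>T\<close>:
    the partner is matched to \<open>x X\<close>, and \<open>near\<close> matches the remaining
    vertices. By \<open>cover\<close> and \<open>fT\<close> the pieces partition
    \<open>V\<close>.\<close>
  define A where "A X = insert (x X) (insert (f X) (X - {x X}))" for X
  define F where "F X = insert {x X, f X} {e \<in> E. e \<subseteq> X - {x X}}" for X
  have "\<forall>X\<in>C. \<exists>M. perfect_matching (X - {x X}) {e \<in> E. e \<subseteq> X - {x X}} M"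
    using near x(1) by blast
  then obtain M where M: "\<And>X. X \<in> C \<Longrightarrow> perfect_matching (X - {x X}) {e \<in> E. e \<subseteq> X - {x X}} (M X)"
    by metis
  have fX: "f X \<notin> Y" if "X \<in> C" "Y \<in> C" for X Y
    using fT od(3)[OF that(2)] that(1) by blast
  have A_eq: "A X = insert (f X) X" if "X \<in> C" for X using x(1)[OF that] by (auto simp: A_def)
  have "perfect_matching (\<Union>(A ` C)) (\<Union>(F ` C)) (\<Union>((\<lambda>X. insert {x X, f X} (M X)) ` C))"
  proof (rule perfect_matching_Union)
    fix X assume X: "X \<in> C"
    show "perfect_matching (A X) (F X) (insert {x X, f X} (M X))"
      unfolding A_def F_def
      by (rule perfect_matching_insert[OF M[OF X]]) (use fX[OF X X] in auto)
    show "e \<subseteq> A X" if "e \<in> F X" for e using that by (auto simp: A_def F_def)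
    fix Y assume Y: "Y \<in> C" "X \<noteq> Y"
    have "f X \<noteq> f Y" using inj_onD[OF f(1)] X Y by blast
    moreover have "X \<inter> Y = {}" using od(2) X Y by (auto simp: pairwise_def disjnt_def)
    ultimately show "A X \<inter> A Y = {}"
      using fX[OF X Y(1)] fX[OF Y(1) X] by (simp add: A_eq X Y)
  qed
  moreover have "\<Union>(A ` C) = V"
  proof -
    have "\<Union>(A ` C) = f ` C \<union> \<Union>C" using A_eq by auto
    also have "\<dots> = V" using fT cover od(1,3) by blast
    finally show ?thesis .
  qed
  moreover have "\<Union>(F ` C) \<subseteq> E" using x(2) by (auto simp: F_def)
  ultimately show ?case using perfect_matching_mono by metis
qed

subsection \<open>Cuts of regular graphs\<close>

text \<open>An edge with both ends in \<open>A \<inter> B\<close> is counted twice.\<close>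

definition arcs :: "'a set set \<Rightarrow> 'a set \<Rightarrow> 'a set \<Rightarrow> nat" where
  "arcs E A B = card {(u, v). u \<in> A \<and> v \<in> B \<and> {u, v} \<in> E}"

lemma finite_arcs:
  assumes "finite A" "finite B"
  shows "finite {(u, v). u \<in> A \<and> v \<in> B \<and> {u, v} \<in> E}"
  by (rule finite_subset[of _ "A \<times> B"]) (use assms in auto)

lemma arcs_commute: "arcs E A B = arcs E B A"
proof -
  have "{(u, v). u \<in> B \<and> v \<in> A \<and> {u, v} \<in> E} = prod.swap ` {(u, v). u \<in> A \<and> v \<in> B \<and> {u, v} \<in> E}"
    by (auto simp: insert_commute image_iff)
  then show ?thesis unfolding arcs_def by (simp add: card_image)
qed

lemma arcs_Un_left:
  assumes "finite A" "finite A'" "finite B" "A \<inter> A' = {}"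
  shows "arcs E (A \<union> A') B = arcs E A B + arcs E A' B"
proof -
  have "{(u, v). u \<in> A \<union> A' \<and> v \<in> B \<and> {u, v} \<in> E} =
      {(u, v). u \<in> A \<and> v \<in> B \<and> {u, v} \<in> E} \<union> {(u, v). u \<in> A' \<and> v \<in> B \<and> {u, v} \<in> E}"
    by auto
  moreover have "{(u, v). u \<in> A \<and> v \<in> B \<and> {u, v} \<in> E} \<inter> {(u, v). u \<in> A' \<and> v \<in> B \<and> {u, v} \<in> E} = {}"
    using assms(4) by auto
  ultimately show ?thesis
    unfolding arcs_def using assms by (simp add: card_Un_disjoint finite_arcs)
qed

lemma arcs_Un_right:
  assumes "finite A" "finite B" "finite B'" "B \<inter> B' = {}"
  shows "arcs E A (B \<union> B') = arcs E A B + arcs E A B'"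
  using arcs_Un_left[OF assms(2,3,1,4)] by (simp add: arcs_commute[of E A])

lemma arcs_empty [simp]: "arcs E {} B = 0"
  by (simp add: arcs_def)

lemma arcs_Union_left:
  assumes "finite C" "pairwise disjnt C" "\<And>X. X \<in> C \<Longrightarrow> finite X" "finite B"
  shows "arcs E (\<Union>C) B = (\<Sum>X\<in>C. arcs E X B)"
  using assms
proof (induction C rule: finite_induct)
  case (insert X C)
  have "X \<inter> \<Union>C = {}"
    using insert.prems(1) insert.hyps by (auto simp: pairwise_insert disjnt_def)
  then show ?case
    using insert by (simp add: arcs_Un_left pairwise_insert)
qed simp

lemma arcs_eq_sum:
  assumes "finite A" "finite B"
  shows "arcs E A B = (\<Sum>a\<in>A. arcs E {a} B)"
  using assms
proof (induction A rule: finite_induct)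
  case (insert a A)
  then show ?case using arcs_Un_left[of "{a}" A B E] by simp
qed simp

lemma arcs_mono:
  assumes "A \<subseteq> A'" "B \<subseteq> B'" "finite A'" "finite B'"
  shows "arcs E A B \<le> arcs E A' B'"
  unfolding arcs_def using assms by (intro card_mono finite_arcs) auto

lemma arcs_Diff:
  assumes "M \<subseteq> E" "finite A" "finite B"
  shows "arcs E A B = arcs M A B + arcs (E - M) A B"
proof -
  have "{(u, v). u \<in> A \<and> v \<in> B \<and> {u, v} \<in> E} =
      {(u, v). u \<in> A \<and> v \<in> B \<and> {u, v} \<in> M} \<union> {(u, v). u \<in> A \<and> v \<in> B \<and> {u, v} \<in> E - M}"
    using assms(1) by auto
  moreover have "{(u, v). u \<in> A \<and> v \<in> B \<and> {u, v} \<in> M} \<inter> {(u, v). u \<in> A \<and> v \<in> B \<and> {u, v} \<in> E - M} = {}"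
    by auto
  ultimately show ?thesis
    using card_Un_disjoint[OF finite_arcs[OF assms(2,3)] finite_arcs[OF assms(2,3)], of M "E - M"]
    unfolding arcs_def by metis
qed

lemma arcs_singleton: "arcs E {a} B = card {b \<in> B. {a, b} \<in> E}"
proof -
  have "{(u, v). u \<in> {a} \<and> v \<in> B \<and> {u, v} \<in> E} = Pair a ` {b \<in> B. {a, b} \<in> E}" by auto
  then show ?thesis unfolding arcs_def by (simp add: card_image inj_on_def)
qed

lemma no_loop: "simple_graph V E \<Longrightarrow> {a, a} \<notin> E"
  by (auto simp: simple_graph_def)

text \<open>Adding a vertex \<open>a\<close> to \<open>A\<close> adds each edge between them in both
  directions, and no loop.\<close>

lemma arcs_self_even:
  assumes "simple_graph V E" "finite A"
  shows "even (arcs E A A)"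
  using assms(2)
proof (induction A rule: finite_induct)
  case (insert a A)
  have "arcs E {a} {a} = 0" using no_loop[OF assms(1)] by (simp add: arcs_singleton)
  then have "arcs E (insert a A) (insert a A) = 2 * arcs E {a} A + arcs E A A"
    using insert arcs_Un_left[of "{a}" A "insert a A" E]
      arcs_Un_right[of "{a}" "{a}" A E] arcs_Un_right[of A "{a}" A E] arcs_commute[of E A "{a}"]
    by simp
  then show ?case using insert by simp
qed simp

lemma arcs_self_le:
  assumes "simple_graph V E" "finite A"
  shows "arcs E A A \<le> card A * (card A - 1)"
proof -
  have "arcs E {a} A \<le> card A - 1" if "a \<in> A" for a
  proof -
    have "card {b \<in> A. {a, b} \<in> E} \<le> card (A - {a})"
      using no_loop[OF assms(1)] assms(2) by (intro card_mono) auto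
    then show ?thesis using that assms(2) by (simp add: arcs_singleton)
  qed
  then have "(\<Sum>a\<in>A. arcs E {a} A) \<le> (\<Sum>a\<in>A. card A - 1)" by (intro sum_mono)
  then show ?thesis using arcs_eq_sum[OF assms(2,2)] by simp
qed

text \<open>Fixing the first coordinate removes the double count: each edge at \<open>a\<close>
  gives one ordered pair starting at \<open>a\<close>.\<close>

lemma arcs_eq_degree:
  assumes "simple_graph V E" "a \<in> V"
  shows "arcs E {a} V = graph_degree E a"
proof -
  have "bij_betw (\<lambda>b. {a, b}) {b \<in> V. {a, b} \<in> E} {e \<in> E. a \<in> e}"
    unfolding bij_betw_def
  proof
    show "inj_on (\<lambda>b. {a, b}) {b \<in> V. {a, b} \<in> E}" by (auto simp: inj_on_def doubleton_eq_iff)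
    show "(\<lambda>b. {a, b}) ` {b \<in> V. {a, b} \<in> E} = {e \<in> E. a \<in> e}"
    proof
      show "{e \<in> E. a \<in> e} \<subseteq> (\<lambda>b. {a, b}) ` {b \<in> V. {a, b} \<in> E}"
      proof
        fix e assume "e \<in> {e \<in> E. a \<in> e}"
        then have e: "e \<in> E" "a \<in> e" by simp_all
        then obtain b where "e = {a, b}" "b \<in> V" using edge_eq[OF assms(1)] by blast
        then show "e \<in> (\<lambda>b. {a, b}) ` {b \<in> V. {a, b} \<in> E}" using e by blast
      qed
    qed auto
  qed
  then show ?thesis unfolding arcs_singleton graph_degree_def by (rule bij_betw_same_card)
qed

lemma arcs_matching:
  assumes "simple_graph V E" "perfect_matching V E M" "v \<in> V"
  shows "arcs M {v} V = 1"
proof -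
  have "simple_graph V M" using assms(1,2) by (auto simp: simple_graph_def perfect_matching_def)
  then have "arcs M {v} V = card {e \<in> M. v \<in> e}"
    using arcs_eq_degree assms(3) by (metis graph_degree_def)
  moreover have "\<exists>!e. e \<in> M \<and> v \<in> e" using assms(2,3) by (simp add: perfect_matching_def)
  then have "card {e \<in> M. v \<in> e} = 1" by (auto simp: card_1_singleton_iff elim!: ex1E)
  ultimately show ?thesis by simp
qed

lemma arcs_regular:
  assumes "finite V" "\<And>v. v \<in> V \<Longrightarrow> arcs E {v} V = d" "A \<subseteq> V"
  shows "arcs E A V = d * card A"
proof -
  have "finite A" using assms(1,3) by (rule finite_subset[rotated])
  then have "arcs E A V = (\<Sum>a\<in>A. arcs E {a} V)" using assms(1) by (rule arcs_eq_sum)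
  also have "\<dots> = (\<Sum>a\<in>A. d)" using assms(2,3) by (intro sum.cong) auto
  finally show ?thesis by simp
qed

lemma arcs_regular_cut:
  assumes "finite V" "\<And>v. v \<in> V \<Longrightarrow> arcs E {v} V = d" "A \<subseteq> V"
  shows "d * card A = arcs E A A + arcs E A (V - A)"
proof -
  have "finite A" using assms(1,3) by (rule finite_subset[rotated])
  then have "arcs E A (A \<union> (V - A)) = arcs E A A + arcs E A (V - A)"
    using assms(1) by (intro arcs_Un_right) auto
  moreover have "A \<union> (V - A) = V" using assms(3) by blast
  ultimately show ?thesis using arcs_regular[OF assms] by simp
qed

text \<open>\<open>d * card A\<close> counts the edge ends at \<open>A\<close>, and those on inner
  edges come in pairs.\<close>

lemma even_cut_iff:
  assumes "simple_graph V E" "\<And>v. v \<in> V \<Longrightarrow> arcs E {v} V = d" "A \<subseteq> V"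
  shows "even (arcs E A (V - A)) \<longleftrightarrow> even (d * card A)"
proof -
  have fV: "finite V" using assms(1) by (simp add: simple_graph_def)
  have "even (arcs E A A)" by (rule arcs_self_even[OF assms(1) finite_subset[OF assms(3) fV]])
  then show ?thesis using arcs_regular_cut[OF fV assms(2,3)] by simp
qed

lemma odd_family_cut:
  assumes "odd_family V E T C" "X \<in> C"
  shows "arcs E X (V - X) = arcs E X T"
proof -
  note od = odd_familyD[OF assms(1)]
  have "v \<in> T" if "u \<in> X" "v \<notin> X" "{u, v} \<in> E" for u v
    using od(6)[OF assms(2) that(3)] that(1,2) by blast
  moreover have "T \<subseteq> V - X" using od(1) od(3)[OF assms(2)] by blast
  ultimately have "{(u, v). u \<in> X \<and> v \<in> V - X \<and> {u, v} \<in> E} = {(u, v). u \<in> X \<and> v \<in> T \<and> {u, v} \<in> E}"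
    by blast
  then show ?thesis by (simp add: arcs_def)
qed

text \<open>The double count behind both applications of Tutte's theorem: lower bounds on the single
  cuts add up against the degree sum of \<open>T\<close>.\<close>

lemma odd_family_cut_sum:
  assumes "odd_family V E T C" "finite V"
  shows "(\<Sum>X\<in>C. arcs E X (V - X)) = arcs E T (\<Union>C)"
proof -
  note od = odd_familyD[OF assms(1)] and fin = odd_family_finite[OF assms]
  have "(\<Sum>X\<in>C. arcs E X (V - X)) = (\<Sum>X\<in>C. arcs E X T)"
    using odd_family_cut[OF assms(1)] by (intro sum.cong) auto
  also have "\<dots> = arcs E (\<Union>C) T"
    using fin od(2) by (intro arcs_Union_left[symmetric]) auto
  finally show ?thesis by (simp add: arcs_commute)
qed

lemma no_matching_odd_family:
  assumes "simple_graph V E" "even (card V)" "\<nexists>M. perfect_matching V E M"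
  obtains T C where "odd_family V E T C" "card T + 2 \<le> card C"
proof -
  obtain T C where "odd_family V E T C" "card T < card C"
    using tutte[OF assms(1)] assms(3) by (meson not_le)
  then show ?thesis using odd_family_exceeds_by_two[OF _ assms(1,2)] that by blast
qed

section \<open>Cuts and matchings in 3-connected 4-regular graphs\<close>

text \<open>By parity a smaller cut has at most two edges. Deleting their ends outside
  \<open>X\<close> would separate \<open>X\<close> from \<open>y\<close>, which survives because it
  has no neighbour in \<open>X\<close>.\<close>

lemma three_connected_cut:
  assumes "simple_graph V E" "vertex_connected 3 V E" and reg: "\<And>v. v \<in> V \<Longrightarrow> arcs E {v} V = 4"
    and X: "X \<subseteq> V" "X \<noteq> {}" and y: "y \<in> V" "y \<notin> X" "\<And>x. x \<in> X \<Longrightarrow> {x, y} \<notin> E"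
  shows "4 \<le> arcs E X (V - X)"
proof (rule ccontr)
  assume "\<not> 4 \<le> arcs E X (V - X)"
  moreover have "even (arcs E X (V - X))" using even_cut_iff[OF assms(1) reg X(1)] by simp
  ultimately have cut: "arcs E X (V - X) < 3" by (cases "arcs E X (V - X) = 3") auto
  have fV: "finite V" using assms(1) by (simp add: simple_graph_def)
  have fX: "finite X" using X fV by (auto intro: finite_subset)
  define P where "P = {(u, v). u \<in> X \<and> v \<in> V - X \<and> {u, v} \<in> E}"
  define N where "N = snd ` P"
  have fP: "finite P" using finite_arcs[OF fX, of "V - X" E] fV by (simp add: P_def)
  have cardN: "card N \<le> arcs E X (V - X)"
    unfolding N_def arcs_def P_def[symmetric] using fP by (rule card_image_le)
  have N: "b \<in> N" if "a \<in> X" "b \<in> V" "b \<notin> X" "{a, b} \<in> E" for a b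
    using that by (force simp: N_def P_def)
  have "card N < 3" using cut cardN by simp
  moreover have "N \<subseteq> V - X" by (auto simp: N_def P_def)
  ultimately have conn: "graph_connected (V - N) {e \<in> E. e \<inter> N = {}}"
    using assms(2) unfolding vertex_connected_def by (meson Diff_subset order_trans)
  obtain x where x: "x \<in> X" using X by blast
  have yN: "y \<in> V - N" using y by (auto simp: N_def P_def)
  have xN: "x \<in> V - N" using x X by (auto simp: N_def P_def)
  have "(x, y) \<in> {(a, b). a \<in> V - N \<and> b \<in> V - N \<and> {a, b} \<in> {e \<in> E. e \<inter> N = {}}}\<^sup>*"
    using conn xN yN unfolding graph_connected_def by blast
  then have "y \<in> X"
  \<comment> \<open>A path can leave \<open>X\<close> only through \<open>N\<close>, which has been
    deleted.\<close>
  proof (induction rule: rtrancl_induct)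
    case (step a b)
    have b: "b \<in> V" "b \<notin> N" "{a, b} \<in> E" using step.hyps(2) by auto
    then show ?case using N step.IH by blast
  qed (fact x)
  then show False using y by blast
qed

text \<open>A cut of at most three edges reaches at most three vertices outside \<open>X\<close>, so
  the size condition leaves a vertex without neighbours in \<open>X\<close>, as
  \<open>three_connected_cut\<close> asks.\<close>

lemma three_connected_small_cut:
  assumes "simple_graph V E" "vertex_connected 3 V E" and reg: "\<And>v. v \<in> V \<Longrightarrow> arcs E {v} V = 4"
    and X: "X \<subseteq> V" "X \<noteq> {}" "card X + 4 \<le> card V"
  shows "4 \<le> arcs E X (V - X)"
proof (rule ccontr)
  assume cut: "\<not> 4 \<le> arcs E X (V - X)"
  have fV: "finite V" using assms(1) by (simp add: simple_graph_def)
  have fX: "finite X" using X fV by (auto intro: finite_subset)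
  define P where "P = {(u, v). u \<in> X \<and> v \<in> V - X \<and> {u, v} \<in> E}"
  define N where "N = snd ` P"
  have fP: "finite P" using finite_arcs[OF fX, of "V - X" E] fV by (simp add: P_def)
  have cardN: "card N \<le> arcs E X (V - X)"
    unfolding N_def arcs_def P_def[symmetric] using fP by (rule card_image_le)
  have N: "b \<in> N" if "a \<in> X" "b \<in> V" "b \<notin> X" "{a, b} \<in> E" for a b
    using that by (force simp: N_def P_def)
  have "card (X \<union> N) < card V" using X(3) card_Un_le[of X N] cardN cut by linarith
  moreover have "finite (X \<union> N)" using fX fP by (simp add: N_def)
  ultimately have "\<not> V \<subseteq> X \<union> N" using card_mono[of "X \<union> N" V] by linarith
  then obtain y where y: "y \<in> V" "y \<notin> X" "y \<notin> N" by blast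
  then have "{x, y} \<notin> E" if "x \<in> X" for x using N that by blast
  then show False using three_connected_cut[OF assms(1-3) X(1,2), of y] y cut by blast
qed

text \<open>With the ends of \<open>e\<close> removed, an obstruction would have at least
  \<open>card T + 2\<close> members, each sending at least four edges to \<open>T\<close> or to the
  ends of \<open>e\<close>. These vertices have at most \<open>4 * (card T + 2)\<close> edge ends,
  and \<open>e\<close> itself takes some of them.\<close>

lemma three_connected_matching_covered:
  assumes "simple_graph V E" "vertex_connected 3 V E" "graph_regular 4 V E" "even (card V)"
  shows "matching_covered V E"
  unfolding matching_covered_def
proof (intro conjI ballI)
  have "graph_connected (V - {}) {e \<in> E. e \<inter> {} = {}}"
    using assms(2) unfolding vertex_connected_def by (metis card.empty empty_subsetI zero_less_numeral)
  then show "graph_connected V E" by simp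
  have fV: "finite V" using assms(1) by (simp add: simple_graph_def)
  have reg: "arcs E {v} V = 4" if "v \<in> V" for v
    using arcs_eq_degree[OF assms(1) that] assms(3) that by (simp add: graph_regular_def)
  fix e assume e: "e \<in> E"
  then have "card e = 2" using assms(1) by (simp add: simple_graph_def)
  then obtain u where "u \<in> e" by fastforce
  then obtain w where w: "e = {u, w}" "u \<noteq> w" "u \<in> V" "w \<in> V" using edge_eq[OF assms(1) e] by blast
  let ?W = "V - {u, w}"
  let ?F = "{f \<in> E. f \<subseteq> ?W}"
  have simpleW: "simple_graph ?W ?F" by (rule simple_graph_induced[OF assms(1)]) auto
  have "\<exists>M. perfect_matching ?W ?F M"
  proof (rule ccontr)
    assume no: "\<nexists>M. perfect_matching ?W ?F M"
    have "even (card ?W)" using assms(4) w fV by (simp add: card_Diff_subset)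
    then obtain T C where TC: "odd_family ?W ?F T C" "card T + 2 \<le> card C"
      using no_matching_odd_family[OF simpleW _ no] by blast
    let ?T = "T \<union> {u, w}"
    have of: "odd_family V E ?T C"
    proof (rule odd_family_lift[OF TC(1) assms(1)])
      show "f \<subseteq> ?W \<union> {u, w}" if "f \<in> E" for f using assms(1) that by (auto simp: simple_graph_def)
    qed (use w in auto)
    note od = odd_familyD[OF of] and fin = odd_family_finite[OF of fV]
    have cut: "4 \<le> arcs E X (V - X)" if X: "X \<in> C" for X
    proof -
      \<comment> \<open>A vertex of a second member has no neighbour in \<open>X\<close>; it serves
        as \<open>y\<close> in the cut bound.\<close>
      have "\<exists>Y\<in>C. Y \<noteq> X"
      proof (rule ccontr)
        assume "\<not> (\<exists>Y\<in>C. Y \<noteq> X)"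
        then have "card C \<le> card {X}" by (intro card_mono) auto
        then show False using TC(2) by simp
      qed
      then obtain Y where Y: "Y \<in> C" "Y \<noteq> X" by blast
      then obtain y where y: "y \<in> Y" using od(5) by blast
      have "X \<inter> Y = {}" using od(2) X Y by (auto simp: pairwise_def disjnt_def)
      then have yX: "y \<notin> X" using y by blast
      have yV: "y \<in> V" "y \<notin> ?T" using y od(3)[OF Y(1)] by blast+
      have "{x, y} \<notin> E" if "x \<in> X" for x
        using od(6)[OF X, of "{x, y}"] that yX yV(2) by blast
      then show ?thesis
        using three_connected_cut[OF assms(1,2) reg _ od(5)[OF X] yV(1) yX] od(3)[OF X] by blast
    qed
    have "4 * card C \<le> (\<Sum>X\<in>C. arcs E X (V - X))"
      using sum_mono[of C "\<lambda>_. 4" "\<lambda>X. arcs E X (V - X)"] cut by simp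
    also have "\<dots> = arcs E ?T (\<Union>C)" by (rule odd_family_cut_sum[OF of fV])
    finally have lower: "4 * card C \<le> arcs E ?T (\<Union>C)" .
    have "arcs E ?T ?T + arcs E ?T (\<Union>C) = arcs E ?T (?T \<union> \<Union>C)"
      using fin od(3) by (intro arcs_Un_right[symmetric]) auto
    also have "\<dots> \<le> arcs E ?T V" using od(1,3) fV fin(1) by (intro arcs_mono) auto
    also have "\<dots> = 4 * card ?T" by (rule arcs_regular[OF fV reg od(1)])
    also have "\<dots> \<le> 4 * (card T + 2)" using card_Un_le[of T "{u, w}"] w by simp
    finally have upper: "arcs E ?T ?T + arcs E ?T (\<Union>C) \<le> 4 * (card T + 2)" .
    \<comment> \<open>The edge \<open>e\<close> lies inside \<open>?T\<close>, which makes the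
      comparison strict.\<close>
    have "arcs E {u} {w} = 1"
      using e w by (simp add: arcs_singleton Collect_conv_if conj_commute cong: conj_cong)
    moreover have "arcs E {u} {w} \<le> arcs E ?T ?T" using fin by (intro arcs_mono) auto
    ultimately have "4 * card C < 4 * (card T + 2)" using lower upper by linarith
    then show False using TC(2) by simp
  qed
  then obtain M where M: "perfect_matching ?W ?F M" by blast
  have "perfect_matching (insert u (insert w ?W)) (insert {u, w} ?F) (insert {u, w} M)"
    by (rule perfect_matching_insert[OF M]) auto
  moreover have "insert u (insert w ?W) = V" using w by blast
  ultimately have "perfect_matching V E (insert {u, w} M)"
    using e w(1) by (auto intro: perfect_matching_mono)
  then show "\<exists>M. perfect_matching V E M \<and> e \<in> M" using w(1) by blast
qed

subsection \<open>Bridges of cubic graphs\<close>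

text \<open>
  By parity every set of a Tutte obstruction of the cubic graph \<open>H\<close> has an odd cut, and the cuts
  have at most \<open>3 |T|\<close> edges altogether, so at least three of the \<open>|T| + 2\<close> cuts are bridges of \<open>H\<close>.
\<close>

lemma cubic_no_matching:
  assumes "simple_graph V F" "H \<subseteq> F" and reg: "\<And>v. v \<in> V \<Longrightarrow> arcs H {v} V = 3"
    and "even (card V)" "\<nexists>M. perfect_matching V F M"
  obtains A where "card A = 3" "pairwise disjnt A"
    "\<And>X. X \<in> A \<Longrightarrow> X \<subseteq> V" "\<And>X. X \<in> A \<Longrightarrow> odd (card X)" "\<And>X. X \<in> A \<Longrightarrow> arcs H X (V - X) = 1"
    "\<And>X Y x y. X \<in> A \<Longrightarrow> Y \<in> A \<Longrightarrow> X \<noteq> Y \<Longrightarrow> x \<in> X \<Longrightarrow> y \<in> Y \<Longrightarrow> {x, y} \<notin> F"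
proof -
  have fV: "finite V" using assms(1) by (simp add: simple_graph_def)
  have simpleH: "simple_graph V H" using assms(1,2) by (auto simp: simple_graph_def)
  obtain T C where of: "odd_family V F T C" and TC: "card T + 2 \<le> card C"
    using no_matching_odd_family[OF assms(1,4,5)] .
  note od = odd_familyD[OF of] and fin = odd_family_finite[OF of fV]
  \<comment> \<open>The obstruction comes from \<open>F\<close>, so no edge of \<open>F\<close>
    joins two members; the cuts are counted in the cubic subgraph \<open>H\<close>, for which it is
    an obstruction as well.\<close>
  have ofH: "odd_family V H T C"
    by (rule odd_family_shrink[OF of]) (use assms(2) od(1,3) in auto)
  define B where "B = {X \<in> C. arcs H X (V - X) = 1}"
  have odd_cut: "odd (arcs H X (V - X))" if "X \<in> C" for X
    using even_cut_iff[OF simpleH reg, of X] od(3,4)[OF that] by auto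
  \<comment> \<open>An odd cut with more than one edge has at least three.\<close>
  have "(if X \<in> B then 1 else 3) \<le> arcs H X (V - X)" if "X \<in> C" for X
  proof -
    have "arcs H X (V - X) \<noteq> 0" "arcs H X (V - X) \<noteq> 2" using odd_cut[OF that] by (metis even_zero, metis even_numeral)
    then show ?thesis using that by (auto simp: B_def)
  qed
  then have "(\<Sum>X\<in>C. if X \<in> B then 1 else 3) \<le> (\<Sum>X\<in>C. arcs H X (V - X))" by (rule sum_mono)
  also have "\<dots> = arcs H T (\<Union>C)" by (rule odd_family_cut_sum[OF ofH fV])
  also have "\<dots> \<le> arcs H T V" using od(1,3) fV fin by (intro arcs_mono) auto
  also have "\<dots> = 3 * card T" by (rule arcs_regular[OF fV reg od(1)])
  finally have "(\<Sum>X\<in>C. if X \<in> B then 1 else 3) \<le> 3 * card T" .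
  moreover have "B \<subseteq> C" by (auto simp: B_def)
  then have "(\<Sum>X\<in>C. if X \<in> B then 1 else 3) = card B + 3 * (card C - card B)" "card B \<le> card C"
    using fin by (auto simp: sum.If_cases Int_absorb1 card_Diff_subset finite_subset Diff_eq[symmetric] intro: card_mono)
  \<comment> \<open>With \<open>b = card B\<close>, the inequality
    \<open>b + 3 * (card C - b) \<le> 3 * card T\<close> and the surplus of two give
    \<open>2 * b \<ge> 6\<close>.\<close>
  ultimately have "3 \<le> card B" using TC by linarith
  then obtain A where A: "A \<subseteq> B" "card A = 3" by (meson obtain_subset_with_card_n)
  then have AC: "A \<subseteq> C" using \<open>B \<subseteq> C\<close> by blast
  show ?thesis
  proof
    show "card A = 3" by fact
    show "pairwise disjnt A" using od(2) AC by (rule pairwise_subset)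
    show "X \<subseteq> V" "odd (card X)" "arcs H X (V - X) = 1" if "X \<in> A" for X
      using that AC A(1) od(3,4)[of X] by (auto simp: B_def)
    fix X Y x y assume *: "X \<in> A" "Y \<in> A" "X \<noteq> Y" "x \<in> X" "y \<in> Y"
    then have "X \<in> C" "Y \<in> C" using AC by blast+
    moreover have "X \<inter> Y = {}" using od(2) * calculation by (auto simp: pairwise_def disjnt_def)
    ultimately show "{x, y} \<notin> F"
      using od(6)[of X "{x, y}"] od(3)[of Y] * by blast
  qed
qed

text \<open>All but one of the \<open>3 * n\<close> edge ends at the \<open>n = card X\<close>
  vertices lie on inner edges, so \<open>3 * n \<le> n * (n - 1) + 1\<close>. This fails for the odd
  values 1 and 3.\<close>

lemma cubic_bridge_card:
  assumes "simple_graph V H" and reg: "\<And>v. v \<in> V \<Longrightarrow> arcs H {v} V = 3"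
    and X: "X \<subseteq> V" "odd (card X)" "arcs H X (V - X) = 1"
  shows "5 \<le> card X"
proof (rule ccontr)
  have fV: "finite V" using assms(1) by (simp add: simple_graph_def)
  then have "arcs H X X \<le> card X * (card X - 1)"
    using X(1) by (intro arcs_self_le[OF assms(1)]) (rule finite_subset)
  then have "3 * card X \<le> card X * (card X - 1) + 1"
    using arcs_regular_cut[OF fV reg X(1)] X(3) by simp
  moreover assume "\<not> 5 \<le> card X"
  then consider "card X = 0" | "card X = 1" | "card X = 2" | "card X = 3" | "card X = 4" by linarith
  then have "card X \<in> {1, 3}" using X(2) by cases auto
  ultimately show False by auto
qed

text \<open>Two vertices share at most one edge, which uses two of their six edge ends.\<close>

lemma cubic_pair_cut:
  assumes "simple_graph V H" and reg: "\<And>v. v \<in> V \<Longrightarrow> arcs H {v} V = 3"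
    and X: "X \<subseteq> V" "card X = 2"
  shows "4 \<le> arcs H X (V - X)"
proof -
  have fV: "finite V" using assms(1) by (simp add: simple_graph_def)
  then have "arcs H X X \<le> card X * (card X - 1)"
    using X(1) by (intro arcs_self_le[OF assms(1)]) (rule finite_subset)
  then show ?thesis using arcs_regular_cut[OF fV reg X(1)] X(2) by simp
qed

text \<open>Uncrossing: the cuts of \<open>X \<inter> Y\<close> and \<open>X \<union> Y\<close> have
  sizes adding up to at most two, and so do those of \<open>X - Y\<close> and \<open>Y - X\<close>.
  Parity selects the pair whose cuts are odd, hence single edges. A set cut off in this way has at
  least five vertices, so what remains of \<open>X\<close> or \<open>Y\<close> has at most two;
  being even, it is empty or a pair, and a pair has too large a cut.\<close>

lemma cubic_bridges_laminar:
  assumes "simple_graph V H" and reg: "\<And>v. v \<in> V \<Longrightarrow> arcs H {v} V = 3"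
    and X: "X \<subseteq> V" "odd (card X)" "arcs H X (V - X) = 1" "card X \<le> 7"
    and Y: "Y \<subseteq> V" "odd (card Y)" "arcs H Y (V - Y) = 1" "card Y \<le> 7"
    and meet: "X \<inter> Y \<noteq> {}"
  shows "X = Y"
proof -
  have fV: "finite V" using assms(1) by (simp add: simple_graph_def)
  define P Q R S where "P = X \<inter> Y" and "Q = X - Y" and "R = Y - X" and "S = V - X - Y"
  note defs = P_def Q_def R_def S_def
  have sub: "P \<subseteq> V" "Q \<subseteq> V" "R \<subseteq> V" "P \<union> (Q \<union> R) \<subseteq> V" and fin: "finite P" "finite Q" "finite R" "finite S"
    using X(1) Y(1) fV by (auto simp: defs intro: finite_subset)
  have XPQ: "X = P \<union> Q" and YPR: "Y = P \<union> R" by (auto simp: defs)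
  have dis: "P \<inter> Q = {}" "P \<inter> R = {}" "Q \<inter> R = {}" "P \<inter> S = {}" "Q \<inter> S = {}" "R \<inter> S = {}"
    "Q \<inter> P = {}" "R \<inter> P = {}" "R \<inter> Q = {}" "S \<inter> P = {}" "S \<inter> Q = {}" "S \<inter> R = {}"
    by (auto simp: defs)
  have compl: "V - X = R \<union> S" "V - Y = Q \<union> S" "V - P = Q \<union> (R \<union> S)" "V - Q = P \<union> (R \<union> S)"
    "V - R = P \<union> (Q \<union> S)" "V - (P \<union> (Q \<union> R)) = S"
    using X(1) Y(1) by (auto simp: defs)
  let ?a = "arcs H"
  note expand = compl arcs_Un_left arcs_Un_right fin dis Int_Un_distrib Int_Un_distrib2
  \<comment> \<open>All cuts are expressed by the six edge counts between \<open>P\<close>,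
    \<open>Q\<close>, \<open>R\<close> and \<open>S\<close>, so that uncrossing becomes linear
    arithmetic.\<close>
  have cX: "?a X (V - X) = ?a P R + ?a P S + ?a Q R + ?a Q S"
    unfolding compl(1) unfolding XPQ by (simp add: expand)
  have cY: "?a Y (V - Y) = ?a P Q + ?a P S + ?a Q R + ?a R S"
    unfolding compl(2) unfolding YPR by (simp add: expand arcs_commute[of H R Q])
  have cP: "?a P (V - P) = ?a P Q + ?a P R + ?a P S" by (simp add: expand)
  have cQ: "?a Q (V - Q) = ?a P Q + ?a Q R + ?a Q S" by (simp add: expand arcs_commute[of H Q P])
  have cR: "?a R (V - R) = ?a P R + ?a Q R + ?a R S"
    by (simp add: expand arcs_commute[of H R P] arcs_commute[of H R Q])
  have cU: "?a (P \<union> (Q \<union> R)) (V - (P \<union> (Q \<union> R))) = ?a P S + ?a Q S + ?a R S" by (simp add: expand)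
  have card: "card X = card P + card Q" "card Y = card P + card R" "card (P \<union> (Q \<union> R)) = card P + (card Q + card R)"
    unfolding XPQ YPR using fin dis by (simp_all add: card_Un_disjoint Int_Un_distrib)
  have par: "odd (?a Z (V - Z)) \<longleftrightarrow> odd (card Z)" if "Z \<subseteq> V" for Z
    using even_cut_iff[OF assms(1) reg that] by simp
  have five: "5 \<le> card Z" if "Z \<subseteq> V" "?a Z (V - Z) = 1" for Z
    using cubic_bridge_card[OF assms(1) reg that(1) _ that(2)] par[OF that(1)] that(2) by simp
  have pair: "4 \<le> ?a Z (V - Z)" if "Z \<subseteq> V" "card Z = 2" for Z
    using cubic_pair_cut[OF assms(1) reg that] by simp
  have bound: "?a P R + ?a P S + ?a Q R + ?a Q S = 1" "?a P Q + ?a P S + ?a Q R + ?a R S = 1"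
    using X(3) Y(3) cX cY by simp_all
  show ?thesis
  proof (cases "odd (card P)")
    case True
    have "odd (card (P \<union> (Q \<union> R)))" using True X(2) Y(2) card by simp
    then have "?a (P \<union> (Q \<union> R)) (V - (P \<union> (Q \<union> R))) \<noteq> 0" using par[OF sub(4)] by (metis even_zero)
    moreover have "?a P (V - P) \<noteq> 0" using par[OF sub(1)] True by (metis even_zero)
    ultimately have P1: "?a P (V - P) = 1" using bound cU cP by linarith
    then have "5 \<le> card P" by (rule five[OF sub(1)])
    then have "card Q \<le> 2" "card R \<le> 2" using card X(4) Y(4) by linarith+
    moreover have "even (card Q)" "even (card R)" using True X(2) Y(2) card by simp_all
    \<comment> \<open>The cut of a pair has at least four edges, while \<open>bound\<close> allows
      \<open>Q\<close> at most two.\<close>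
    moreover have "card Q \<noteq> 2" using pair[OF sub(2)] cQ cP bound P1 by linarith
    moreover have "card R \<noteq> 2" using pair[OF sub(3)] cR cP bound P1 by linarith
    ultimately have "card Q = 0" "card R = 0" by (metis One_nat_def Suc_1 le_Suc_eq le_zero_eq odd_one)+
    then show ?thesis using fin XPQ YPR by simp
  next
    case False
    then have "odd (card Q)" "odd (card R)" using X(2) Y(2) card by simp_all
    then have "?a Q (V - Q) \<noteq> 0" "?a R (V - R) \<noteq> 0" using par[OF sub(2)] par[OF sub(3)] by (metis even_zero)+
    then have Q1: "?a Q (V - Q) = 1" using bound cQ cR by linarith
    then have "5 \<le> card Q" by (rule five[OF sub(2)])
    then have "card P \<le> 2" using card X(4) by linarith
    moreover have "card P \<noteq> 0" using meet fin by (simp add: P_def)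
    ultimately have "card P = 2" using False by (metis One_nat_def Suc_1 le_Suc_eq le_zero_eq odd_one)
    then have "4 \<le> ?a P (V - P)" by (rule pair[OF sub(1)])
    then show ?thesis using cP cQ bound Q1 by linarith
  qed
qed

text \<open>
  Deleting a perfect matching \<open>M\<close> leaves a cubic graph with at most 18 vertices.  It has at most
  three odd sets of size at most 7 cut off by a bridge, since these are disjoint and have at
  least five vertices each; so any two Tutte obstructions share the same three such sets.
  They send at least nine edges of \<open>M\<close> outside, and only three can end in the other vertices.
\<close>

lemma matching_meeting_in_one_edge:
  assumes "simple_graph V E" "vertex_connected 3 V E" and reg: "\<And>v. v \<in> V \<Longrightarrow> arcs E {v} V = 4"
    and "even (card V)" "card V \<le> 18" and M: "perfect_matching V E M"
  shows "\<exists>f\<in>E. \<exists>M'. perfect_matching V E M' \<and> M \<inter> M' \<subseteq> {f}"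
proof -
  have fV: "finite V" using assms(1) by (simp add: simple_graph_def)
  have ME: "M \<subseteq> E" using M by (simp add: perfect_matching_def)
  define H where "H = E - M"
  have HE: "H \<subseteq> E" by (auto simp: H_def)
  have simpleH: "simple_graph V H" using assms(1) HE by (auto simp: simple_graph_def)
  have regM: "arcs M {v} V = 1" if "v \<in> V" for v by (rule arcs_matching[OF assms(1) M that])
  have regH: "arcs H {v} V = 3" if "v \<in> V" for v
    using arcs_Diff[OF ME, of "{v}" V] fV reg[OF that] regM[OF that] by (simp add: H_def)
  have "card V > 3" using assms(2) by (simp add: vertex_connected_def)
  then obtain v where v: "v \<in> V" by fastforce
  then obtain e0 where "e0 \<in> M" using M by (auto simp: perfect_matching_def)
  then have e0: "e0 \<in> E" using ME by blast
  show ?thesis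
  proof (cases "\<exists>M'. perfect_matching V H M'")
    case True
    then obtain M' where M': "perfect_matching V H M'" by blast
    \<comment> \<open>Here \<open>M\<close> and \<open>M'\<close> are disjoint; \<open>e0\<close>
      merely fills the place of \<open>f\<close>.\<close>
    then have "M \<inter> M' \<subseteq> {e0}" by (auto simp: perfect_matching_def H_def)
    then show ?thesis using e0 perfect_matching_mono[OF M' HE] by blast
  next
    case False
    obtain A where A: "card A = 3" "pairwise disjnt A"
      "\<And>X. X \<in> A \<Longrightarrow> X \<subseteq> V" "\<And>X. X \<in> A \<Longrightarrow> odd (card X)" "\<And>X. X \<in> A \<Longrightarrow> arcs H X (V - X) = 1"
      using cubic_no_matching[OF simpleH order_refl regH assms(4) False] by metis
    have five: "5 \<le> card X" if "X \<subseteq> V" "odd (card X)" "arcs H X (V - X) = 1" for X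
      using cubic_bridge_card[OF simpleH regH that] by simp
    \<comment> \<open>Five vertices for each member, plus what \<open>X\<close> has beyond
      five.\<close>
    have union_card: "5 * card B + (card X - 5) \<le> card (\<Union>B)"
      if "finite B" "pairwise disjnt B" "X \<in> B"
        "\<And>Y. Y \<in> B \<Longrightarrow> Y \<subseteq> V" "\<And>Y. Y \<in> B \<Longrightarrow> odd (card Y)" "\<And>Y. Y \<in> B \<Longrightarrow> arcs H Y (V - Y) = 1" for B X
    proof -
      have "card (\<Union>B) = (\<Sum>Y\<in>B. card Y)"
        using that(2,4) fV by (intro card_Union_disjoint) (auto intro: finite_subset)
      also have "\<dots> = card X + (\<Sum>Y\<in>B - {X}. card Y)" using that(1,3) by (rule sum.remove)
      also have "\<dots> \<ge> card X + (\<Sum>Y\<in>B - {X}. 5)"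
        by (intro add_left_mono sum_mono five that(4-6)) auto
      finally have "card X + 5 * (card B - 1) \<le> card (\<Union>B)" using that(1,3) by simp
      moreover have "0 < card B" using that(1,3) by (auto simp: card_gt_0_iff)
      moreover have "5 \<le> card X" using that(3) by (intro five that(4-6))
      ultimately show ?thesis by linarith
    qed
    have le18: "card (\<Union>B) \<le> 18" if "\<And>X. X \<in> B \<Longrightarrow> X \<subseteq> V" for B
      using card_mono[OF fV, of "\<Union>B"] that assms(5) by (meson Sup_least le_trans)
    have seven: "card X \<le> 7" if "card B = 3" "pairwise disjnt B" "X \<in> B"
        "\<And>Y. Y \<in> B \<Longrightarrow> Y \<subseteq> V" "\<And>Y. Y \<in> B \<Longrightarrow> odd (card Y)" "\<And>Y. Y \<in> B \<Longrightarrow> arcs H Y (V - Y) = 1" for B X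
    proof -
      have "finite B" using that(1) by (simp add: card_ge_0_finite)
      from union_card[OF this that(2-6)] have "15 + (card X - 5) \<le> card (\<Union>B)" using that(1) by simp
      \<comment> \<open>The bound \<open>15 + (card X - 5) \<le> 18\<close> allows 8, which oddness
        then excludes.\<close>
      then have "card X \<le> 8" using le18[of B] that(4) by fastforce
      then show ?thesis using that(5)[OF that(3)] by (cases "card X = 8") auto
    qed
    have finA: "finite A" using A(1) by (simp add: card_ge_0_finite)
    have finX: "finite X" if "X \<in> A" for X using A(3)[OF that] fV by (rule finite_subset)
    define R where "R = V - \<Union>A"
    obtain X0 where X0: "X0 \<in> A" using A(1) by fastforce
    have UA: "\<Union>A \<subseteq> V" "15 \<le> card (\<Union>A)"
      using A(3) union_card[OF finA A(2) X0 A(3-5)] A(1) by auto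
    have cardR: "card R \<le> 3"
      using UA assms(5) fV by (simp add: R_def card_Diff_subset finite_subset)
    have "\<exists>X\<in>A. \<exists>Y\<in>A. X \<noteq> Y \<and> (\<exists>x\<in>X. \<exists>y\<in>Y. {x, y} \<in> M)"
    proof (rule ccontr)
      assume no: "\<not> ?thesis"
      have "3 \<le> arcs M X R" if X: "X \<in> A" for X
      proof -
        \<comment> \<open>\<open>X\<close> has at most 7 vertices, while \<open>V\<close> has at
          least 15.\<close>
        have "card X + 4 \<le> card V"
          using seven[OF A(1,2) X A(3-5)] UA fV card_mono[OF fV UA(1)] by linarith
        then have "4 \<le> arcs E X (V - X)"
          using A(3,4)[OF X] by (intro three_connected_small_cut[OF assms(1,2) reg]) auto
        moreover have "arcs E X (V - X) = arcs M X (V - X) + arcs H X (V - X)"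
          unfolding H_def using finX[OF X] fV by (intro arcs_Diff[OF ME]) auto
        ultimately have "3 \<le> arcs M X (V - X)" using A(5)[OF X] by simp
        moreover have "b \<in> R" if "a \<in> X" "b \<in> V - X" "{a, b} \<in> M" for a b
          using no X that by (auto simp: R_def)
        then have "arcs M X (V - X) \<le> arcs M X R"
          unfolding arcs_def using finX[OF X] fV
          by (intro card_mono finite_arcs) (auto simp: R_def)
        ultimately show ?thesis by simp
      qed
      then have "(\<Sum>X\<in>A. 3) \<le> (\<Sum>X\<in>A. arcs M X R)" by (rule sum_mono)
      also have "\<dots> = arcs M (\<Union>A) R"
        using finA A(2) finX fV by (intro arcs_Union_left[symmetric]) (auto simp: R_def)
      also have "\<dots> = arcs M R (\<Union>A)" by (rule arcs_commute)
      also have "\<dots> \<le> arcs M R V" using UA(1) fV by (intro arcs_mono) (auto simp: R_def)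
      also have "\<dots> = 1 * card R" by (rule arcs_regular[OF fV regM]) (auto simp: R_def)
      finally show False using A(1) cardR by simp
    qed
    then obtain X Y x y where XY: "X \<in> A" "Y \<in> A" "X \<noteq> Y" "x \<in> X" "y \<in> Y" "{x, y} \<in> M" by blast
    define F where "F = insert {x, y} H"
    have FE: "F \<subseteq> E" using HE ME XY(6) by (auto simp: F_def)
    have simpleF: "simple_graph V F" using assms(1) FE by (auto simp: simple_graph_def)
    have "\<exists>M'. perfect_matching V F M'"
    proof (rule ccontr)
      assume no: "\<nexists>M'. perfect_matching V F M'"
      have HF: "H \<subseteq> F" by (auto simp: F_def)
      obtain B where B: "card B = 3" "pairwise disjnt B"
        "\<And>X. X \<in> B \<Longrightarrow> X \<subseteq> V" "\<And>X. X \<in> B \<Longrightarrow> odd (card X)" "\<And>X. X \<in> B \<Longrightarrow> arcs H X (V - X) = 1"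
        and sep: "\<And>X Y x y. X \<in> B \<Longrightarrow> Y \<in> B \<Longrightarrow> X \<noteq> Y \<Longrightarrow> x \<in> X \<Longrightarrow> y \<in> Y \<Longrightarrow> {x, y} \<notin> F"
        using cubic_no_matching[OF simpleF HF regH assms(4) no] by blast
      have "Z \<in> A" if Z: "Z \<in> B" for Z
      proof (rule ccontr)
        assume ZA: "Z \<notin> A"
        have "disjnt Z W" if W: "W \<in> A" for W
        proof -
          have "Z = W" if "Z \<inter> W \<noteq> {}"
            by (rule cubic_bridges_laminar[OF simpleH regH])
              (use that A(3-5)[OF W] B(3-5)[OF Z] seven[OF A(1,2) W A(3-5)] seven[OF B(1,2) Z B(3-5)] in auto)
          then show ?thesis using ZA W by (auto simp: disjnt_def)
        qed
        then have "pairwise disjnt (insert Z A)"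
          using A(2) by (auto simp: pairwise_insert disjnt_sym)
        \<comment> \<open>A fourth disjoint set would require at least 20 vertices out of at most
          18.\<close>
        then have "5 * card (insert Z A) + (card Z - 5) \<le> card (\<Union>(insert Z A))"
          using finA A(3-5) B(3-5)[OF Z] by (intro union_card) auto
        moreover have "card (\<Union>(insert Z A)) \<le> 18" using A(3) B(3)[OF Z] by (intro le18) auto
        ultimately show False using ZA finA A(1) by simp
      qed
      then have "B = A" using A(1) B(1) finA by (intro card_subset_eq) auto
      \<comment> \<open>\<open>sep\<close> forbids edges of \<open>F\<close> between members of
        \<open>B\<close>, but \<open>{x, y}\<close> joins two members of \<open>A\<close>.\<close>
      then show False using sep[of X Y x y] XY by (auto simp: F_def)
    qed
    then obtain M' where M': "perfect_matching V F M'" by blast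
    then have "M \<inter> M' \<subseteq> {{x, y}}" by (auto simp: perfect_matching_def F_def H_def)
    then show ?thesis using XY(6) ME perfect_matching_mono[OF M' FE] by blast
  qed
qed

section \<open>Assembling the three perfect matchings\<close>

theorem theorem3p2:
  fixes V :: "'a set" and E :: "'a set set"
  assumes "simple_graph V E"
    and "vertex_connected 3 V E"
    and "graph_regular 4 V E"
    and "even (card V)"
    and "card V \<le> 18"
  shows "three_PM_admissible V E"
proof -
  have mc: "matching_covered V E" by (rule three_connected_matching_covered[OF assms(1-4)])
  have deg: "graph_degree E v = 4" if "v \<in> V" for v using assms(3) that by (simp add: graph_regular_def)
  have reg: "arcs E {v} V = 4" if "v \<in> V" for v using arcs_eq_degree[OF assms(1) that] deg[OF that] by simp
  have "card V > 3" using assms(2) by (simp add: vertex_connected_def)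
  then obtain v where v: "v \<in> V" by fastforce
  then have "{e \<in> E. v \<in> e} \<noteq> {}" using deg[OF v] unfolding graph_degree_def by (metis card.empty zero_neq_numeral)
  then obtain M1 where M1: "perfect_matching V E M1" using mc by (auto simp: matching_covered_def)
  obtain f M2 where f: "f \<in> E" and M2: "perfect_matching V E M2" "M1 \<inter> M2 \<subseteq> {f}"
    using matching_meeting_in_one_edge[OF assms(1,2) reg assms(4,5) M1] by blast
  have "card f = 2" using assms(1) f by (simp add: simple_graph_def)
  then obtain u where u: "u \<in> f" by fastforce
  then have "u \<in> V" using assms(1) f by (auto simp: simple_graph_def)
  \<comment> \<open>Since \<open>u\<close> has degree 4, a second edge \<open>g\<close> meets
    \<open>f\<close> at \<open>u\<close>. A perfect matching through \<open>g\<close> covers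
    \<open>u\<close> by \<open>g\<close> and hence omits \<open>f\<close>, the only edge that
    \<open>M1\<close> and \<open>M2\<close> can share.\<close>
  have "\<not> {e \<in> E. u \<in> e} \<subseteq> {f}"
  proof
    assume "{e \<in> E. u \<in> e} \<subseteq> {f}"
    then have "card {e \<in> E. u \<in> e} \<le> card {f}" by (intro card_mono) auto
    then show False using deg[OF \<open>u \<in> V\<close>] by (simp add: graph_degree_def)
  qed
  then obtain g where g: "g \<in> E" "u \<in> g" "g \<noteq> f" by blast
  obtain M3 where M3: "perfect_matching V E M3" "g \<in> M3" using mc g(1) by (auto simp: matching_covered_def)
  then have "f \<notin> M3" using g(2,3) u \<open>u \<in> V\<close> unfolding perfect_matching_def by blast
  then have "M1 \<inter> M2 \<inter> M3 = {}" using M2(2) by blast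
  then show ?thesis unfolding three_PM_admissible_def using mc M1 M2(1) M3(1) by blast
qed

end
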